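(* For every integer $n\geq 4$, $$f(n)\geq 4n-2\left\lceil \frac{3+\sqrt{8n-7}}{2}\right\rceil+2 .$$
   Context: All graphs are finite and simple; a graph is nonempty if it has at least one edge. A numbering of a graph $G$ of order $n$ is a bijection $g:V(G)\to\{1,\dots,n\}$. For a nonempty graph $G$, $\mathrm{str}_g(G)=\max\{g(u)+g(v) : uv\in E(G)\}$, and the strength of $G$ is $\mathrm{str}(G)=\min\{\mathrm{str}_g(G) : g \text{ is a numbering of } G\}$. Define $f(n)=\max\{\mathrm{str}(G)+\mathrm{str}(\overline{G})\}$, where the maximum is over all graphs $G$ of order $n$ such that both $G$ and its complement $\overline{G}$ are nonempty. *)

theory Defs
  imports Complex_Main "Graph_Theory.Pair_Digraph"
begin

text \<open>
  Finite simple graphs are the symmetric loop-free finite digraphs \<^locale>\<open>pair_graph\<close>: an edge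
  \<open>uv\<close> is represented by the two arcs \<open>(u, v)\<close> and \<open>(v, u)\<close>.
\<close>

definition graph_complement :: "'a pair_pre_digraph \<Rightarrow> 'a pair_pre_digraph" where
  "graph_complement G =
     \<lparr> pverts = pverts G,
       parcs = {(u, v). u \<in> pverts G \<and> v \<in> pverts G \<and> u \<noteq> v \<and> (u, v) \<notin> parcs G} \<rparr>"

definition nonempty_graph :: "'a pair_pre_digraph \<Rightarrow> bool" where
  "nonempty_graph G \<longleftrightarrow> parcs G \<noteq> {}"

definition numbering :: "'a pair_pre_digraph \<Rightarrow> ('a \<Rightarrow> nat) \<Rightarrow> bool" where
  "numbering G g \<longleftrightarrow> bij_betw g (pverts G) {1..card (pverts G)}"

definition numbering_strength :: "'a pair_pre_digraph \<Rightarrow> ('a \<Rightarrow> nat) \<Rightarrow> nat" where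
  "numbering_strength G g = Max {g u + g v | u v. (u, v) \<in> parcs G}"

definition strength :: "'a pair_pre_digraph \<Rightarrow> nat" where
  "strength G = Min {numbering_strength G g | g. numbering G g}"

text \<open>
  The vertices are taken to be natural numbers, so that all graphs of order \<open>n\<close> occur up to
  isomorphism; lemma \<open>strength_sum_le_max_strength_sum\<close> below shows that graphs over other vertex
  types do not give larger values. The sets under the \<open>Max\<close> and \<open>Min\<close> operators here and above
  are finite, and nonempty in all relevant cases, see lemmas \<open>edge_sums\<close>,
  \<open>numbering_strengths\<close> and \<open>strength_sums\<close>.
\<close>

definition max_strength_sum :: "nat \<Rightarrow> nat" where
  "max_strength_sum n = Max {strength G + strength (graph_complement G) | G :: nat pair_pre_digraph.
     pair_graph G \<and> card (pverts G) = n \<and> nonempty_graph G \<and> nonempty_graph (graph_complement G)}"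

lemma pair_graph_iff:
  "pair_graph G \<longleftrightarrow> finite (pverts G) \<and> parcs G \<subseteq> pverts G \<times> pverts G \<and> sym (parcs G) \<and> irrefl (parcs G)"
proof
  assume "pair_graph G"
  then interpret pair_graph G .
  show "finite (pverts G) \<and> parcs G \<subseteq> pverts G \<times> pverts G \<and> sym (parcs G) \<and> irrefl (parcs G)"
    using pair_finite_verts pair_sym_arcs pair_no_loops in_arcsD1 in_arcsD2
    by (force simp: symmetric_def irrefl_def)
next
  assume A: "finite (pverts G) \<and> parcs G \<subseteq> pverts G \<times> pverts G \<and> sym (parcs G) \<and> irrefl (parcs G)"
  then have "finite (parcs G)"
    using finite_subset by blast
  with A show "pair_graph G"
    by unfold_locales (auto simp: symmetric_def irrefl_def)
qed

lemma pair_graphD: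
  assumes "pair_graph G" "(u, v) \<in> parcs G"
  shows "u \<in> pverts G" "v \<in> pverts G" "u \<noteq> v" "(v, u) \<in> parcs G"
  using assms by (auto simp: pair_graph_iff irrefl_def dest: symD)

lemma pair_graph_complement: "pair_graph G \<Longrightarrow> pair_graph (graph_complement G)"
  by (auto simp: pair_graph_iff graph_complement_def sym_def irrefl_def)

lemma graph_complement_twice:
  "pair_graph G \<Longrightarrow> graph_complement (graph_complement G) = G"
  unfolding pair_graph_iff graph_complement_def irrefl_def
  by (cases G) auto

lemma edge_sums:
  assumes "pair_graph G"
  shows "finite {g u + g v | u v. (u, v) \<in> parcs G}"
    and "nonempty_graph G \<Longrightarrow> {g u + g v | u v. (u, v) \<in> parcs G} \<noteq> {}"
proof -
  have "finite (parcs G)"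
    using assms unfolding pair_graph_iff by (meson finite_SigmaI finite_subset)
  moreover have "{g u + g v | u v. (u, v) \<in> parcs G} = (\<lambda>(u, v). g u + g v) ` parcs G"
    by force
  ultimately show "finite {g u + g v | u v. (u, v) \<in> parcs G}"
    by simp
  show "nonempty_graph G \<Longrightarrow> {g u + g v | u v. (u, v) \<in> parcs G} \<noteq> {}"
    by (auto simp: nonempty_graph_def)
qed

lemma numbering_strength_le:
  assumes "pair_graph G" "nonempty_graph G" "numbering G g"
  shows "numbering_strength G g \<le> 2 * card (pverts G)"
proof -
  have "g u \<le> card (pverts G)" if "u \<in> pverts G" for u
    using assms(3) that by (auto simp: numbering_def bij_betw_def)
  then have "g u + g v \<le> 2 * card (pverts G)" if "(u, v) \<in> parcs G" for u v
    using pair_graphD(1,2)[OF assms(1) that] by (simp add: add_mono mult_2)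
  then show ?thesis
    using edge_sums[OF assms(1), of g] assms(2) by (auto simp: numbering_strength_def)
qed

lemma numbering_strengths:
  assumes "pair_graph G"
  shows "nonempty_graph G \<Longrightarrow> finite {numbering_strength G g | g. numbering G g}"
    and "{numbering_strength G g | g. numbering G g} \<noteq> {}"
proof -
  show "finite {numbering_strength G g | g. numbering G g}" if "nonempty_graph G"
    using numbering_strength_le[OF assms that]
    by - (rule finite_subset[of _ "{..2 * card (pverts G)}"], auto)
  have "finite (pverts G)"
    using assms by (simp add: pair_graph_iff)
  then have "\<exists>g. numbering G g"
    unfolding numbering_def by (intro finite_same_card_bij) auto
  then show "{numbering_strength G g | g. numbering G g} \<noteq> {}"
    by blast
qed

lemma strength_le:
  assumes "pair_graph G" "nonempty_graph G"
  shows "strength G \<le> 2 * card (pverts G)"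
proof -
  have "strength G \<in> {numbering_strength G g | g. numbering G g}"
    unfolding strength_def by (intro Min_in numbering_strengths assms)
  then show ?thesis
    using numbering_strength_le[OF assms] by auto
qed

lemma strength_sums:
  defines "S \<equiv> \<lambda>n. {strength G + strength (graph_complement G) | G :: nat pair_pre_digraph.
     pair_graph G \<and> card (pverts G) = n \<and> nonempty_graph G \<and> nonempty_graph (graph_complement G)}"
  shows "finite (S n)" and "n \<ge> 3 \<Longrightarrow> S n \<noteq> {}"
proof -
  have "x \<le> 4 * n" if "x \<in> S n" for x
  proof -
    from that obtain G :: "nat pair_pre_digraph" where
      x: "x = strength G + strength (graph_complement G)" and
      G: "pair_graph G" "card (pverts G) = n" "nonempty_graph G" "nonempty_graph (graph_complement G)"
      unfolding S_def by blast
    have "card (pverts (graph_complement G)) = n"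
      using G by (simp add: graph_complement_def)
    then show ?thesis
      using strength_le[OF G(1,3)] strength_le[OF pair_graph_complement[OF G(1)] G(4)] G(2) x by simp
  qed
  then show "finite (S n)"
    by - (rule finite_subset[of _ "{..4 * n}"], auto)
  show "S n \<noteq> {}" if "n \<ge> 3"
  proof -
    define G :: "nat pair_pre_digraph" where "G = \<lparr> pverts = {..<n}, parcs = {(0, 1), (1, 0)} \<rparr>"
    have "pair_graph G" "card (pverts G) = n" "nonempty_graph G"
      using that by (auto simp: pair_graph_iff G_def sym_def irrefl_def nonempty_graph_def)
    moreover have "(0, 2) \<in> parcs (graph_complement G)"
      using that by (simp add: G_def graph_complement_def)
    ultimately show ?thesis
      unfolding S_def nonempty_graph_def by blast
  qed
qed

lemma strength_transport_le:
  fixes G :: "'a pair_pre_digraph" and H :: "'b pair_pre_digraph"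
  assumes H: "pair_graph H" "nonempty_graph H" and G: "pair_graph G"
    and h: "bij_betw h (pverts G) (pverts H)" and P: "parcs H = map_prod h h ` parcs G"
  shows "strength H \<le> strength G"
proof -
  have card: "card (pverts H) = card (pverts G)"
    using h by (simp add: bij_betw_same_card)
  define k where "k = inv_into (pverts G) h"
  have kh: "k (h u) = u" if "u \<in> pverts G" for u
    using that h by (simp add: k_def bij_betw_def)
  have k: "bij_betw k (pverts H) (pverts G)"
    unfolding k_def by (rule bij_betw_inv_into[OF h])
  have "strength G \<in> {numbering_strength G g | g. numbering G g}"
    unfolding strength_def
    by (intro Min_in numbering_strengths G) (use H P in \<open>auto simp: nonempty_graph_def\<close>)
  then obtain g where g: "numbering G g" "strength G = numbering_strength G g"
    by blast
  have "numbering H (g \<circ> k)"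
    using bij_betw_trans[OF k g(1)[unfolded numbering_def]] by (simp add: numbering_def card)
  moreover have "numbering_strength H (g \<circ> k) = numbering_strength G g"
  proof -
    have "{(g \<circ> k) u + (g \<circ> k) v | u v. (u, v) \<in> parcs H} =
        (\<lambda>(u, v). g (k (h u)) + g (k (h v))) ` parcs G"
      unfolding P by force
    also have "\<dots> = (\<lambda>(u, v). g u + g v) ` parcs G"
      using pair_graphD(1,2)[OF G] by (intro image_cong) (auto simp: kh)
    also have "\<dots> = {g u + g v | u v. (u, v) \<in> parcs G}"
      by force
    finally show ?thesis
      by (simp add: numbering_strength_def)
  qed
  ultimately have "strength G \<in> {numbering_strength H g | g. numbering H g}"
    using g(2) by force
  then show ?thesis
    unfolding strength_def[of H] using numbering_strengths(1)[OF H] by (intro Min_le)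
qed

lemma strength_sum_le_max_strength_sum:
  fixes G :: "'a pair_pre_digraph"
  assumes G: "pair_graph G" "nonempty_graph G" "nonempty_graph (graph_complement G)"
  shows "strength G + strength (graph_complement G) \<le> max_strength_sum (card (pverts G))"
proof -
  have fin: "finite (pverts G)"
    using G by (simp add: pair_graph_iff)
  obtain k :: "nat \<Rightarrow> 'a" where k: "bij_betw k {..<card (pverts G)} (pverts G)"
    using ex_bij_betw_nat_finite[OF fin] by (auto simp: atLeast0LessThan)
  define n where "n = card (pverts G)"
  define H where "H = \<lparr> pverts = {..<n}, parcs = {(i, j). i < n \<and> j < n \<and> (k i, k j) \<in> parcs G} \<rparr>"
  have k_in: "k i \<in> pverts G" if "i < n" for i
    using k that by (auto simp: n_def bij_betw_def)
  have k_eq: "k i = k j \<longleftrightarrow> i = j" if "i < n" "j < n" for i j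
    using k that by (auto simp: n_def bij_betw_def inj_on_def)
  have k_surj: "\<exists>i<n. u = k i" if "u \<in> pverts G" for u
    using k that by (auto simp: n_def bij_betw_def)
  have H: "pair_graph H"
    using pair_graphD(3,4)[OF G(1)]
    unfolding pair_graph_iff H_def by (auto simp: sym_def irrefl_def)
  have PG: "parcs G = map_prod k k ` parcs H"
  proof (intro equalityI subrelI)
    fix u v assume uv: "(u, v) \<in> parcs G"
    obtain i j where "i < n" "u = k i" "j < n" "v = k j"
      using pair_graphD(1,2)[OF G(1) uv] k_surj by blast
    then show "(u, v) \<in> map_prod k k ` parcs H"
      using uv by (intro image_eqI[of _ _ "(i, j)"]) (auto simp: H_def)
  qed (auto simp: H_def)
  have PC: "parcs (graph_complement G) = map_prod k k ` parcs (graph_complement H)"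
  proof (intro equalityI subrelI)
    fix u v assume uv: "(u, v) \<in> parcs (graph_complement G)"
    obtain i j where "i < n" "u = k i" "j < n" "v = k j"
      using pair_graphD(1,2)[OF pair_graph_complement[OF G(1)] uv] k_surj
      unfolding graph_complement_def pair_pre_digraph.simps by blast
    then show "(u, v) \<in> map_prod k k ` parcs (graph_complement H)"
      using uv by (intro image_eqI[of _ _ "(i, j)"]) (auto simp: H_def graph_complement_def)
  qed (auto simp: H_def graph_complement_def k_in k_eq)
  have "strength G \<le> strength H"
    using strength_transport_le[OF G(1,2) H _ PG] k by (simp add: H_def n_def)
  moreover have "strength (graph_complement G) \<le> strength (graph_complement H)"
    using strength_transport_le[OF pair_graph_complement[OF G(1)] G(3) pair_graph_complement[OF H] _ PC] k
    by (simp add: H_def n_def graph_complement_def)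
  moreover have "strength H + strength (graph_complement H) \<le> max_strength_sum n"
  proof -
    have "card (pverts H) = n"
      by (simp add: H_def)
    moreover have "nonempty_graph H" "nonempty_graph (graph_complement H)"
      using G(2,3) unfolding nonempty_graph_def PG PC by blast+
    ultimately show ?thesis
      unfolding max_strength_sum_def
      by (intro Max_ge[OF strength_sums(1)] CollectI exI[of _ H]) (simp add: H)
  qed
  ultimately show ?thesis
    by (simp add: n_def)
qed

end

theory Submission
  imports Defs
begin

text \<open>
  The witness is a disjoint union of cliques, on \<open>n\<close> vertices cut into blocks of size at most \<open>t\<close>.

  A numbering has small strength only if the vertices with the largest numbers span few edges. Two
  features of a graph prevent this. If every vertex has fewer than \<open>t\<close> non-neighbours, then the
  vertex numbered \<open>n\<close> is adjacent to one of the \<open>t\<close> vertices numbered just below it, so the strength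
  is at least \<open>2n - t\<close> (lemma \<open>strength_ge_of_few_nonneighbours\<close>). If there is no independent set of
  size \<open>m + 1\<close>, then two of the \<open>m + 1\<close> largest numbered vertices are adjacent, so the strength is
  at least \<open>2n - 2m + 1\<close> (lemma \<open>strength_ge_of_no_large_independent_set\<close>).

  In a union of at most \<open>m\<close> cliques, an independent set takes at most one vertex from each clique.
  In its complement, the non-neighbours of a vertex are the other members of its clique, and there
  are fewer than \<open>t\<close> of them. With \<open>m = \<lfloor>(t + 1) / 2\<rfloor>\<close> both strengths are at least \<open>2n - t\<close>, and
  the blocks have room for all vertices as soon as \<open>n \<le> t m\<close>. For \<open>t \<ge> 2\<close> this holds when
  \<open>n \<le> t (t - 1) / 2 + 1\<close>. Solving this quadratic inequality for \<open>t\<close> gives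
  \<open>t + 1 \<ge> (3 + sqrt (8 n - 7)) / 2\<close>, so the least admissible \<open>t\<close> is the ceiling in the bound
  minus one.
\<close>

lemma strength_geI:
  assumes G: "pair_graph G" "nonempty_graph G"
    and edge: "\<And>g. numbering G g \<Longrightarrow> \<exists>u v. (u, v) \<in> parcs G \<and> k \<le> g u + g v"
  shows "k \<le> strength G"
proof -
  have "k \<le> numbering_strength G g" if g: "numbering G g" for g
  proof -
    obtain u v where "(u, v) \<in> parcs G" "k \<le> g u + g v"
      using edge[OF g] by blast
    then show ?thesis
      unfolding numbering_strength_def
      by (intro order_trans[OF _ Max_ge[OF edge_sums(1)[OF G(1)]]]) auto
  qed
  then show ?thesis
    unfolding strength_def using numbering_strengths[OF G(1)] G(2) by auto
qed

lemma card_vertices_numbered_in: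
  assumes "numbering G g" "A \<subseteq> {1..card (pverts G)}"
  shows "card {u \<in> pverts G. g u \<in> A} = card A"
proof (rule bij_betw_same_card)
  show "bij_betw g {u \<in> pverts G. g u \<in> A} A"
    using assms unfolding numbering_def bij_betw_def by (auto intro: inj_on_subset)
qed

lemma strength_ge_of_few_nonneighbours:
  assumes G: "pair_graph G" "nonempty_graph G" and t: "t < card (pverts G)"
    and few: "\<And>u. u \<in> pverts G \<Longrightarrow> card {v \<in> pverts G. v \<noteq> u \<and> (u, v) \<notin> parcs G} < t"
  shows "2 * card (pverts G) - t \<le> strength G"
proof (rule strength_geI[OF G])
  fix g assume g: "numbering G g"
  define n where "n = card (pverts G)"
  have "n \<in> g ` pverts G"
    using g t by (simp add: numbering_def bij_betw_def n_def)
  then obtain u where u: "u \<in> pverts G" "g u = n"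
    by blast
  let ?A = "{v \<in> pverts G. g v \<in> {n - t..<n}}"
  let ?N = "{v \<in> pverts G. v \<noteq> u \<and> (u, v) \<notin> parcs G}"
  have "{n - t..<n} \<subseteq> {1..card (pverts G)}"
    using t by (auto simp: n_def)
  then have "card ?A = card {n - t..<n}"
    by (rule card_vertices_numbered_in[OF g])
  then have "card ?A = t"
    using t by (simp add: n_def)
  moreover have "finite ?N"
    using G(1) by (simp add: pair_graph_iff)
  ultimately have "\<not> ?A \<subseteq> ?N"
    using few[OF u(1)] card_mono[of ?N ?A] by linarith
  then obtain v where "n - t \<le> g v" "(u, v) \<in> parcs G"
    using u(2) by auto
  then show "\<exists>u v. (u, v) \<in> parcs G \<and> 2 * card (pverts G) - t \<le> g u + g v"
    using u(2) t by (intro exI[of _ u] exI[of _ v]) (auto simp: n_def)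
qed

text \<open>
  The numbers of the two ends of an edge are distinct, and this is where the summand \<open>1\<close> comes from.
\<close>

lemma strength_ge_of_no_large_independent_set:
  assumes G: "pair_graph G" "nonempty_graph G" and m: "m < card (pverts G)"
    and edge: "\<And>S. S \<subseteq> pverts G \<Longrightarrow> card S = Suc m \<Longrightarrow> \<exists>u\<in>S. \<exists>v\<in>S. (u, v) \<in> parcs G"
  shows "2 * card (pverts G) - 2 * m + 1 \<le> strength G"
proof (rule strength_geI[OF G])
  fix g assume g: "numbering G g"
  define n where "n = card (pverts G)"
  let ?S = "{v \<in> pverts G. g v \<in> {n - m..n}}"
  have "{n - m..n} \<subseteq> {1..card (pverts G)}"
    using m by (auto simp: n_def)
  then have "card ?S = card {n - m..n}"
    by (rule card_vertices_numbered_in[OF g])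
  then have "card ?S = Suc m"
    using m by (simp add: n_def)
  then obtain u v where uv: "u \<in> ?S" "v \<in> ?S" "(u, v) \<in> parcs G"
    using edge[of ?S] by auto
  have "g u \<noteq> g v"
    using g uv pair_graphD(3)[OF G(1) uv(3)] by (auto simp: numbering_def bij_betw_def inj_on_def)
  then have "2 * n - 2 * m + 1 \<le> g u + g v"
    using uv by auto
  then show "\<exists>u v. (u, v) \<in> parcs G \<and> 2 * card (pverts G) - 2 * m + 1 \<le> g u + g v"
    using uv(3) by (auto simp: n_def)
qed

definition clique_union :: "nat \<Rightarrow> nat \<Rightarrow> nat pair_pre_digraph" where
  "clique_union t n =
     \<lparr> pverts = {..<n}, parcs = {(u, v). u < n \<and> v < n \<and> u \<noteq> v \<and> u div t = v div t} \<rparr>"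

lemma pair_graph_clique_union: "pair_graph (clique_union t n)"
  by (auto simp: pair_graph_iff clique_union_def sym_def irrefl_def)

lemma nonempty_clique_union:
  assumes "2 \<le> t" "2 \<le> n"
  shows "nonempty_graph (clique_union t n)"
proof -
  have "(0, 1) \<in> parcs (clique_union t n)"
    using assms by (simp add: clique_union_def)
  then show ?thesis
    unfolding nonempty_graph_def by blast
qed

lemma nonempty_complement_clique_union:
  assumes "0 < t" "t < n"
  shows "nonempty_graph (graph_complement (clique_union t n))"
proof -
  have "(0, t) \<in> parcs (graph_complement (clique_union t n))"
    using assms by (simp add: clique_union_def graph_complement_def)
  then show ?thesis
    unfolding nonempty_graph_def by blast
qed

text \<open>The clique of a vertex \<open>u\<close> lies in an interval of \<open>t\<close> integers, and \<open>u\<close> itself is left out.\<close>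

lemma strength_complement_clique_union_ge:
  assumes t: "0 < t" "t < n"
  shows "2 * n - t \<le> strength (graph_complement (clique_union t n))"
proof -
  let ?H = "graph_complement (clique_union t n)"
  have verts: "pverts ?H = {..<n}"
    by (simp add: graph_complement_def clique_union_def)
  have "card {v \<in> pverts ?H. v \<noteq> u \<and> (u, v) \<notin> parcs ?H} < t" if "u \<in> pverts ?H" for u
  proof -
    define b where "b = u div t * t"
    have block: "b \<le> v \<and> v < b + t" if "v div t = u div t" for v
    proof -
      have "b + v mod t = v"
        using div_mult_mod_eq[of v t] that by (simp add: b_def)
      then show ?thesis
        using mod_less_divisor[OF t(1), of v] by linarith
    qed
    have "{v \<in> pverts ?H. v \<noteq> u \<and> (u, v) \<notin> parcs ?H} \<subseteq> {b..<b + t} - {u}"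
      using that block by (auto simp: graph_complement_def clique_union_def)
    then have "card {v \<in> pverts ?H. v \<noteq> u \<and> (u, v) \<notin> parcs ?H} \<le> card ({b..<b + t} - {u})"
      by (intro card_mono) auto
    also have "\<dots> < t"
      using block[of u] t(1) by simp
    finally show ?thesis .
  qed
  then show ?thesis
    using strength_ge_of_few_nonneighbours[OF pair_graph_complement[OF pair_graph_clique_union]
        nonempty_complement_clique_union[OF t]] t(2) by (simp add: verts)
qed

lemma strength_clique_union_ge:
  assumes t: "2 \<le> t" and n: "2 \<le> n" "n \<le> t * m" and m: "m < n"
  shows "2 * n - 2 * m + 1 \<le> strength (clique_union t n)"
proof -
  let ?G = "clique_union t n"
  have verts: "pverts ?G = {..<n}"
    by (simp add: clique_union_def)
  have "\<exists>u\<in>S. \<exists>v\<in>S. (u, v) \<in> parcs ?G" if S: "S \<subseteq> pverts ?G" "card S = Suc m" for S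
  proof -
    have "(\<lambda>u. u div t) ` S \<subseteq> {..<m}"
      using S(1) n(2) t by (auto simp: verts div_less_iff_less_mult mult.commute)
    then have "card ((\<lambda>u. u div t) ` S) \<le> m"
      using card_mono[of "{..<m}"] by simp
    then have "\<not> inj_on (\<lambda>u. u div t) S"
      using S(2) by (intro pigeonhole) simp
    then show ?thesis
      using S(1) unfolding inj_on_def by (auto simp: clique_union_def)
  qed
  then show ?thesis
    using strength_ge_of_no_large_independent_set[OF pair_graph_clique_union
        nonempty_clique_union[OF t n(1)]] m by (simp add: verts)
qed

text \<open>
  The third hypothesis is \<open>n \<le> t (t - 1) / 2 + 1\<close> without the division. The number \<open>m\<close> below is the
  largest number of cliques for which \<open>2n - 2m + 1\<close> is still at least \<open>2n - t\<close>.
\<close>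

lemma max_strength_sum_ge:
  assumes t: "2 \<le> t" "t < n" and n: "2 * n + t \<le> t * t + 2"
  shows "4 * n - 2 * t \<le> max_strength_sum n"
proof -
  define m where "m = (t + 1) div 2"
  have "n \<le> t * m"
  proof (cases "even t")
    case True
    then have "2 * m = t"
      by (simp add: m_def)
    then have "2 * (t * m) = t * t"
      by (metis mult.left_commute)
    then show ?thesis
      using n t(1) by linarith
  next
    case False
    then have "2 * m = t + 1"
      by (simp add: m_def)
    then have "2 * (t * m) = t * (t + 1)"
      by (metis mult.left_commute)
    then have "2 * (t * m) = t * t + t"
      by simp
    then show ?thesis
      using n t(1) by linarith
  qed
  moreover have m: "m < n" "2 * m \<le> t + 1"
    using t by (auto simp: m_def)
  ultimately have "2 * n - t \<le> strength (clique_union t n)"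
    using strength_clique_union_ge[of t n m] t by linarith
  moreover have "2 * n - t \<le> strength (graph_complement (clique_union t n))"
    using t by (intro strength_complement_clique_union_ge) auto
  moreover have "strength (clique_union t n) + strength (graph_complement (clique_union t n))
      \<le> max_strength_sum n"
    using strength_sum_le_max_strength_sum[OF pair_graph_clique_union
        nonempty_clique_union[of t n] nonempty_complement_clique_union[of t n]] t
    by (simp add: clique_union_def)
  ultimately show ?thesis
    by linarith
qed

theorem theorem3p2:
  fixes n :: nat
  assumes "n \<ge> 4"
  shows "int (max_strength_sum n) \<ge> 4 * int n - 2 * \<lceil>(3 + sqrt (8 * real n - 7)) / 2\<rceil> + 2"
proof -
  define r where "r = sqrt (8 * real n - 7)"
  define s where "s = \<lceil>(3 + r) / 2\<rceil>"
  have n: "4 \<le> real n"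
    using assms by linarith
  then have radicand: "0 \<le> 8 * real n - 7"
    by linarith
  have r_sq: "r\<^sup>2 = 8 * real n - 7" and r0: "0 \<le> r"
    unfolding r_def by (rule real_sqrt_pow2[OF radicand], rule real_sqrt_ge_zero[OF radicand])
  \<comment> \<open>This product is a quarter of \<open>(2 n - 3)\<^sup>2 - (8 n - 7)\<close>. Hence the ceiling is at most \<open>n\<close> from
      \<open>n = 4\<close> on, so that \<open>t < n\<close> and there is more than one clique.\<close>
  have "0 \<le> (real n - 1) * (real n - 4)"
    using n by simp
  then have "8 * real n - 7 \<le> (2 * real n - 3)\<^sup>2"
    by (simp add: power2_eq_square algebra_simps)
  then have "r \<le> 2 * real n - 3"
    unfolding r_def using n by (intro real_le_lsqrt) linarith+
  then have s_le: "s \<le> int n"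
    unfolding s_def by (simp add: ceiling_le_iff)
  have "(3 + r) / 2 \<le> real_of_int s"
    unfolding s_def by (rule le_of_int_ceiling)
  then have r_le: "r \<le> 2 * real_of_int s - 3"
    by (simp add: field_simps)
  have "3 < r"
    unfolding r_def using n by (intro real_less_rsqrt) simp
  then have s_ge: "3 < s"
    using r_le by linarith
  define t where "t = nat (s - 1)"
  have st: "s = int t + 1"
    using s_ge by (simp add: t_def)
  have t: "2 \<le> t" "t < n"
    using s_ge s_le st by simp_all
  have "r \<le> 2 * real t - 1"
    using r_le by (simp add: st)
  then have "r\<^sup>2 \<le> (2 * real t - 1)\<^sup>2"
    using r0 by (intro power_mono)
  then have "8 * real n - 7 \<le> (2 * real t - 1)\<^sup>2"
    by (simp only: r_sq)
  then have "real (2 * n + t) \<le> real (t * t + 2)"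
    by (simp add: power2_eq_square algebra_simps)
  then have "2 * n + t \<le> t * t + 2"
    by (simp only: of_nat_le_iff)
  then have "4 * n - 2 * t \<le> max_strength_sum n"
    using t by (intro max_strength_sum_ge)
  then have "4 * int n - 2 * int t \<le> int (max_strength_sum n)"
    by linarith
  then have "4 * int n - 2 * s + 2 \<le> int (max_strength_sum n)"
    by (simp add: st)
  then show ?thesis
    by (simp only: s_def r_def)
qed

end
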